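(* Let $k\geq 1$, $m$ and $t$ be integers with $t\leq \frac{m}{2}-1$. Let $\mathcal{R}$ be the graph obtained from $K_{(k-1)(m-1)+1}$ by deleting the edges of a matching with $t$ edges ($tK_2$), and let $G$ be the graph obtained from $K_m$ by deleting the edges of a matching with $t$ edges. Then $\mathcal{R}$ is $k$-$G$-free-minimal.
   Context: All graphs are finite, simple and undirected. For a graph $G$ on at least 2 vertices, a $G$-free $k$-colouring of a graph $H$ is a map $\pi:V(H)\to\{1,\dots,k\}$ such that for every $i$ the subgraph of $H$ induced by $\pi^{-1}(i)$ contains no subgraph isomorphic to $G$. The $G$-free chromatic number $\chi_G(H)$ is the least $k$ for which a $G$-free $k$-colouring of $H$ exists. $H$ is $G$-free-minimal if $\chi_G(H\setminus\{e\})=\chi_G(H)-1$ for every edge $e\in E(H)$; $H$ is $k$-$G$-free-minimal if moreover $\chi_G(H)=k$. *)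

theory Defs
  imports "Graph_Theory.Graph_Theory" "HOL-Library.Disjoint_Sets"
begin

text \<open>
  A simple undirected graph is a \<^locale>\<open>pair_graph\<close>: a finite, symmetric, loop-free relation on
  its vertex set. An undirected edge corresponds to the two arcs \<open>(u,v)\<close> and \<open>(v,u)\<close> and is
  represented by the two-element set \<open>{u,v}\<close>.
\<close>

definition edges :: "'a pair_pre_digraph \<Rightarrow> 'a set set" where
  "edges H = (\<lambda>(u,v). {u,v}) ` parcs H"

definition delete_edges :: "'a pair_pre_digraph \<Rightarrow> 'a set set \<Rightarrow> 'a pair_pre_digraph" where
  "delete_edges H F = \<lparr>pverts = pverts H, parcs = {(u,v) \<in> parcs H. {u,v} \<notin> F}\<rparr>"

definition matching :: "'a pair_pre_digraph \<Rightarrow> 'a set set \<Rightarrow> bool" where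
  "matching H M \<longleftrightarrow> M \<subseteq> edges H \<and> disjoint M"

definition complete_minus_matching :: "nat \<Rightarrow> nat \<Rightarrow> 'a pair_pre_digraph \<Rightarrow> bool" where
  "complete_minus_matching n t H \<longleftrightarrow>
     (\<exists>C M. complete_digraph n (with_proj C) \<and> matching C M \<and> card M = t \<and> H = delete_edges C M)"

text \<open>Copies of \<open>G\<close> are arbitrary subgraphs, not necessarily induced ones.\<close>

definition contains_copy :: "('a, 'c) pre_digraph \<Rightarrow> 'b pair_pre_digraph \<Rightarrow> bool" where
  "contains_copy H G \<longleftrightarrow> (\<exists>S. subgraph S H \<and> digraph_iso (with_proj G) S)"

definition free_colouring ::
    "'b pair_pre_digraph \<Rightarrow> nat \<Rightarrow> 'a pair_pre_digraph \<Rightarrow> ('a \<Rightarrow> nat) \<Rightarrow> bool" where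
  "free_colouring G k H \<pi> \<longleftrightarrow>
     \<pi> \<in> pverts H \<rightarrow> {1..k} \<and>
     (\<forall>i\<in>{1..k}. \<not> contains_copy (with_proj H \<restriction> {v \<in> pverts H. \<pi> v = i}) G)"

text \<open>
  If \<open>G\<close> has at least two vertices, then an injective colouring of a finite graph is \<open>G\<close>-free,
  so the least element below exists.
\<close>

definition free_chromatic_number :: "'b pair_pre_digraph \<Rightarrow> 'a pair_pre_digraph \<Rightarrow> nat" where
  "free_chromatic_number G H = (LEAST k. \<exists>\<pi>. free_colouring G k H \<pi>)"

definition free_minimal :: "'b pair_pre_digraph \<Rightarrow> 'a pair_pre_digraph \<Rightarrow> bool" where
  "free_minimal G H \<longleftrightarrow>
     (\<forall>e\<in>edges H. int (free_chromatic_number G (delete_edges H {e})) =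
                     int (free_chromatic_number G H) - 1)"

definition k_free_minimal :: "nat \<Rightarrow> 'b pair_pre_digraph \<Rightarrow> 'a pair_pre_digraph \<Rightarrow> bool" where
  "k_free_minimal k G H \<longleftrightarrow> free_minimal G H \<and> free_chromatic_number G H = k"

end

theory Submission
  imports Defs
begin

text \<open>
  With \<open>k - 1\<close> colours some class of \<open>R\<close> has at least \<open>m\<close> vertices, and these span a complete
  graph minus at most \<open>t\<close> matching edges, hence contain \<open>G\<close>; classes of size at most \<open>m - 1\<close> never
  do. After the deletion of an edge \<open>e\<close>, the deleted matching together with \<open>e\<close> covers at most
  \<open>2 t + 2 \<le> m\<close> vertices, so one class of exactly \<open>m\<close> vertices may absorb all of them: it spans
  fewer edges than \<open>G\<close>, and the remaining \<open>(k - 2) (m - 1)\<close> vertices need only \<open>k - 2\<close> colours.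
  Conversely \<open>k - 2\<close> colours do not suffice even for \<open>R\<close> minus an endpoint of \<open>e\<close>.
\<close>

section \<open>Copies of a graph as injective arc-preserving vertex maps\<close>

text \<open>In a pair graph an arc is determined by its ends, so an isomorphism onto a subgraph
  carries no more data than its vertex map. All later arguments use this form and never return to
  \<open>digraph_isomorphism\<close>.\<close>

lemma contains_copy_induced_iff:
  assumes "pair_wf_digraph G"
  shows "contains_copy (with_proj H \<restriction> W) G \<longleftrightarrow>
    (\<exists>f. inj_on f (pverts G) \<and> f ` pverts G \<subseteq> W \<and> (\<forall>(u, v) \<in> parcs G. (f u, f v) \<in> parcs H))"
    (is "?L \<longleftrightarrow> ?R")
proof
  assume ?L
  then obtain S h where S: "subgraph S (with_proj H \<restriction> W)"
    and h: "pre_digraph.digraph_isomorphism (with_proj G) h" and Sh: "S = app_iso h (with_proj G)"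
    unfolding contains_copy_def digraph_iso_def by blast
  \<comment> \<open>A subgraph shares the tail and head maps of its host, here the two
    projections.\<close>
  have ends: "iso_tail h = fst" "iso_head h = snd"
    using S Sh unfolding subgraph_def compatible_def by auto
  have "(iso_verts h u, iso_verts h v) \<in> parcs H" if "(u, v) \<in> parcs G" for u v
  proof -
    have "iso_arcs h (u, v) = (iso_verts h u, iso_verts h v)"
      using h that ends unfolding pre_digraph.digraph_isomorphism_def
      by (metis fst_conv prod.collapse snd_conv with_proj_simps(2,4,5))
    moreover have "iso_arcs h (u, v) \<in> parcs H"
      using S Sh that unfolding subgraph_def by auto
    ultimately show ?thesis by simp
  qed
  moreover have "inj_on (iso_verts h) (pverts G)"
    using h unfolding pre_digraph.digraph_isomorphism_def by simp
  moreover have "iso_verts h ` pverts G \<subseteq> W"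
    using S Sh unfolding subgraph_def by auto
  ultimately show ?R by blast
next
  interpret G: pair_wf_digraph G by fact
  assume ?R
  then obtain f where f: "inj_on f (pverts G)" "f ` pverts G \<subseteq> W"
    "\<And>u v. (u, v) \<in> parcs G \<Longrightarrow> (f u, f v) \<in> parcs H" by fast
  define h where
    "h = \<lparr>iso_verts = f, iso_arcs = map_prod f f, iso_head = snd, iso_tail = fst\<rparr>"
  have fW: "f u \<in> W" "f v \<in> W" if "(u, v) \<in> parcs G" for u v
    using f(2) G.wellformed'[OF that] by blast+
  have "inj_on (map_prod f f) (parcs G)"
    by (rule inj_on_subset[OF map_prod_inj_on[OF f(1) f(1)]]) (auto dest: G.wellformed')
  then have h: "G.digraph_isomorphism h"
    unfolding G.digraph_isomorphism_def using f(1) G.wf_digraph by (auto simp: h_def)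
  have "subgraph (app_iso h (with_proj G)) (with_proj H \<restriction> W)"
    unfolding subgraph_def
  proof (intro conjI)
    show "arcs (app_iso h (with_proj G)) \<subseteq> arcs (with_proj H \<restriction> W)"
      using f(3) fW by (auto simp: h_def)
    show "wf_digraph (app_iso h (with_proj G))" by (rule G.wf_digraphI_app_iso[OF h])
    show "wf_digraph (with_proj H \<restriction> W)" by unfold_locales auto
  qed (use f(2) in \<open>auto simp: h_def compatible_def\<close>)
  with h show ?L unfolding contains_copy_def digraph_iso_def by blast
qed

text \<open>Two obstructions to a copy: the vertex count excludes classes with fewer than
  \<open>m\<close> vertices, the arc count excludes the one class with exactly \<open>m\<close>
  vertices.\<close>

lemma contains_copy_card_le:
  assumes "pair_wf_digraph G" and "contains_copy (with_proj H \<restriction> W) G" and "finite W"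
  shows "card (pverts G) \<le> card W" and "card (parcs G) \<le> card (parcs H \<inter> W \<times> W)"
proof -
  interpret G: pair_wf_digraph G by fact
  obtain f where f: "inj_on f (pverts G)" "f ` pverts G \<subseteq> W"
    "\<And>u v. (u, v) \<in> parcs G \<Longrightarrow> (f u, f v) \<in> parcs H"
    using assms(2) unfolding contains_copy_induced_iff[OF assms(1)] by fast
  show "card (pverts G) \<le> card W" by (rule card_inj_on_le[OF f(1,2) assms(3)])
  have fW: "f u \<in> W" "f v \<in> W" if "(u, v) \<in> parcs G" for u v
    using f(2) G.wellformed'[OF that] by blast+
  have "inj_on (map_prod f f) (parcs G)"
    by (rule inj_on_subset[OF map_prod_inj_on[OF f(1) f(1)]]) (auto dest: G.wellformed')
  moreover have "map_prod f f ` parcs G \<subseteq> parcs H \<inter> W \<times> W"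
    using f(3) fW by auto
  ultimately show "card (parcs G) \<le> card (parcs H \<inter> W \<times> W)"
    using assms(3) by (intro card_inj_on_le) auto
qed

section \<open>Copies inside a complete graph minus a small matching\<close>

text \<open>Pair one edge of \<open>M\<close> with any edge of \<open>N\<close> and remove both;
  disjointness keeps the other edges inside the remaining vertices, so induction applies. For
  missing edges \<open>M\<close> of the host and \<open>N\<close> of \<open>G\<close>, the inverse
  of \<open>f\<close> then sends edges of \<open>G\<close> to edges of the host.\<close>

lemma bij_betw_extending_matching:
  fixes A :: "'a set" and B :: "'b set"
  assumes "finite M" and "finite A" and "finite B" and "card A = card B"
    and "\<forall>e\<in>M. e \<subseteq> A \<and> card e = 2" and "disjoint M"
    and "\<forall>e\<in>N. e \<subseteq> B \<and> card e = 2" and "disjoint N" and "card M \<le> card N"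
  shows "\<exists>f. bij_betw f A B \<and> (\<forall>e\<in>M. f ` e \<in> N)"
  using assms
proof (induction M arbitrary: A B N rule: finite_induct)
  case empty
  then show ?case using finite_same_card_bij by auto
next
  case (insert e M)
  \<comment> \<open>Positive cardinality yields both an element of \<open>N\<close> and its
    finiteness, which is not among the assumptions.\<close>
  from insert.prems(8) insert.hyps have "card N > 0" by simp
  then obtain e' where e': "e' \<in> N" and finN: "finite N" by (auto simp: card_gt_0_iff)
  have e: "e \<subseteq> A" "card e = 2" and e'B: "e' \<subseteq> B" "card e' = 2"
    using insert.prems e' by auto
  have fin: "finite e" "finite e'" using e e'B insert.prems finite_subset by blast+
  have disj: "a \<inter> e = {}" if "a \<in> M" for a
    using disjointD[OF insert.prems(5), of a e] insert.hyps(2) that by auto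
  have disj': "a \<inter> e' = {}" if "a \<in> N - {e'}" for a
    using disjointD[OF insert.prems(7), of a e'] e' that by auto
  have "\<exists>f. bij_betw f (A - e) (B - e') \<and> (\<forall>a\<in>M. f ` a \<in> N - {e'})"
  proof (rule insert.IH)
    show "card (A - e) = card (B - e')"
      using e e'B fin insert.prems(3) by (simp add: card_Diff_subset)
    show "\<forall>a\<in>M. a \<subseteq> A - e \<and> card a = 2"
      using insert.prems(4) disj by auto
    show "\<forall>a\<in>N - {e'}. a \<subseteq> B - e' \<and> card a = 2"
      using insert.prems(6) disj' by auto
    show "disjoint M" "disjoint (N - {e'})"
      using insert.prems(5,7) by (auto simp: pairwise_def)
    show "card M \<le> card (N - {e'})"
      using insert.prems(8) insert.hyps e' finN by simp
  qed (use insert.prems in auto)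
  then obtain f where f: "bij_betw f (A - e) (B - e')" "\<And>a. a \<in> M \<Longrightarrow> f ` a \<in> N - {e'}"
    by blast
  obtain g where g: "bij_betw g e e'"
    using finite_same_card_bij[OF fin] e e'B by auto
  define h where "h = (\<lambda>x. if x \<in> e then g x else f x)"
  have "bij_betw h e e'" using g by (rule bij_betw_cong[THEN iffD1, rotated]) (simp add: h_def)
  moreover have "bij_betw h (A - e) (B - e')"
    using f(1) by (rule bij_betw_cong[THEN iffD1, rotated]) (simp add: h_def)
  ultimately have "bij_betw h (e \<union> (A - e)) (e' \<union> (B - e'))"
    by (rule bij_betw_combine) auto
  then have "bij_betw h A B" using e(1) e'B(1) by (simp add: Un_absorb1)
  moreover have "h ` e = e'"
    using \<open>bij_betw h e e'\<close> by (simp add: bij_betw_def)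
  moreover have "h ` a \<in> N" if "a \<in> M" for a
  proof -
    have "h ` a = f ` a" using disj[OF that] by (intro image_cong) (auto simp: h_def)
    then show ?thesis using f(2)[OF that] by simp
  qed
  ultimately show ?case using e' by blast
qed

lemma complete_minus_matchingE:
  assumes "complete_minus_matching n t H"
  obtains M where "finite (pverts H)" and "card (pverts H) = n"
    and "parcs H = {(u, v). u \<in> pverts H \<and> v \<in> pverts H \<and> u \<noteq> v \<and> {u, v} \<notin> M}"
    and "finite M" and "\<forall>e\<in>M. e \<subseteq> pverts H \<and> card e = 2" and "disjoint M" and "card M = t"
proof -
  obtain C M where C: "complete_digraph n (with_proj C)" and M: "matching C M" "card M = t"
    and H: "H = delete_edges C M"
    using assms unfolding complete_minus_matching_def by blast
  have C': "finite (pverts C)" "card (pverts C) = n"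
    "parcs C = {(u, v). (u, v) \<in> pverts C \<times> pverts C \<and> u \<noteq> v}"
    using C unfolding complete_digraph_pair_def by auto
  have V: "pverts H = pverts C" using H by (simp add: delete_edges_def)
  have M2: "\<forall>e\<in>M. e \<subseteq> pverts H \<and> card e = 2"
    using M(1) C'(3) V unfolding matching_def edges_def by fastforce
  then have "finite M" using C'(1) V by (intro finite_subset[of M "Pow (pverts H)"]) auto
  moreover have "parcs H = {(u, v). u \<in> pverts H \<and> v \<in> pverts H \<and> u \<noteq> v \<and> {u, v} \<notin> M}"
    using H C'(3) by (auto simp: delete_edges_def)
  ultimately show ?thesis
    using that V C' M M2 unfolding matching_def by auto
qed

lemma complete_minus_matching_wf: "pair_wf_digraph H" if "complete_minus_matching n t H"
  using that by (rule complete_minus_matchingE) (unfold_locales, auto)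

text \<open>Any \<open>m\<close> vertices of \<open>S\<close> miss at most \<open>t\<close> pairwise
  disjoint edges; these can be placed on the missing edges of \<open>G\<close>.\<close>

lemma contains_copy_complete_minus_matching:
  assumes G: "complete_minus_matching m t G"
    and S: "S \<subseteq> W" "m \<le> card S"
    and M: "finite M" "\<forall>e\<in>M. card e = 2" "disjoint M" "card M \<le> t"
    and adj: "\<And>u v. \<lbrakk>u \<in> S; v \<in> S; u \<noteq> v; {u, v} \<notin> M\<rbrakk> \<Longrightarrow> (u, v) \<in> parcs H"
  shows "contains_copy (with_proj H \<restriction> W) G"
proof -
  obtain N where N: "finite (pverts G)" "card (pverts G) = m"
    "parcs G = {(u, v). u \<in> pverts G \<and> v \<in> pverts G \<and> u \<noteq> v \<and> {u, v} \<notin> N}"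
    "finite N" "\<forall>e\<in>N. e \<subseteq> pverts G \<and> card e = 2" "disjoint N" "card N = t"
    using G by (rule complete_minus_matchingE)
  obtain S' where S': "S' \<subseteq> S" "card S' = m" "finite S'"
    using S(2) obtain_subset_with_card_n by metis
  \<comment> \<open>Only edges of \<open>M\<close> with both ends in \<open>S'\<close> can be
    missing there.\<close>
  define M' where "M' = {e\<in>M. e \<subseteq> S'}"
  have "\<exists>f. bij_betw f S' (pverts G) \<and> (\<forall>e\<in>M'. f ` e \<in> N)"
  proof (rule bij_betw_extending_matching)
    show "finite M'" using M(1) by (simp add: M'_def)
    have "card M' \<le> card M" using M(1) by (intro card_mono) (auto simp: M'_def)
    then show "card M' \<le> card N" using M(4) N(7) by simp
    show "disjoint M'" using M(3) by (auto simp: M'_def pairwise_def)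
  qed (use N S' M in \<open>auto simp: M'_def\<close>)
  then obtain f where f: "bij_betw f S' (pverts G)" "\<And>e. e \<in> M' \<Longrightarrow> f ` e \<in> N" by blast
  define g where "g = inv_into S' f"
  have g: "bij_betw g (pverts G) S'" unfolding g_def using f(1) by (rule bij_betw_inv_into)
  have fg: "f (g x) = x" if "x \<in> pverts G" for x
    unfolding g_def using f(1) that by (simp add: bij_betw_inv_into_right)
  have "(g u, g v) \<in> parcs H" if "(u, v) \<in> parcs G" for u v
  proof -
    have uv: "u \<in> pverts G" "v \<in> pverts G" "u \<noteq> v" "{u, v} \<notin> N" using that N(3) by auto
    have gS: "g u \<in> S'" "g v \<in> S'" using g uv by (auto simp: bij_betw_def)
    show ?thesis
    proof (rule adj)
      show "g u \<noteq> g v" using fg uv by metis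
      show "{g u, g v} \<notin> M"
      proof
        assume "{g u, g v} \<in> M"
        then have "f ` {g u, g v} \<in> N" using gS by (intro f(2)) (simp add: M'_def)
        then show False using uv fg by simp
      qed
    qed (use gS S' in auto)
  qed
  moreover have "inj_on g (pverts G)" "g ` pverts G \<subseteq> W"
    using g S' S(1) by (auto simp: bij_betw_def)
  ultimately show ?thesis
    unfolding contains_copy_induced_iff[OF complete_minus_matching_wf[OF G]] by blast
qed

section \<open>Counting arcs as ordered pairs\<close>

lemma card_pairs_of_doubletons:
  assumes "finite M" and "\<forall>e\<in>M. card e = 2"
  shows "finite {(u, v). {u, v} \<in> M} \<and> card {(u, v). {u, v} \<in> M} = 2 * card M"
  using assms
proof (induction M rule: finite_induct)
  case empty
  then show ?case by simp
next
  case (insert e M)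
  obtain a b where ab: "e = {a, b}" "a \<noteq> b" using insert.prems by (auto simp: card_2_iff)
  have *: "{(u, v). {u, v} \<in> insert e M} = {(a, b), (b, a)} \<union> {(u, v). {u, v} \<in> M}"
    using ab by (auto simp: doubleton_eq_iff)
  have "{(a, b), (b, a)} \<inter> {(u, v). {u, v} \<in> M} = {}"
    using ab insert.hyps by (auto simp: insert_commute)
  then show ?case
    using insert ab(2) unfolding * by (subst card_Un_disjoint) auto
qed

text \<open>The pairs in \<open>M\<close> may overlap, since the deleted edge can share ends with
  the matching. The additive form lets two graphs on equally many vertices be compared
  directly.\<close>

lemma card_ordered_pairs_minus:
  assumes "finite V" and "finite M" and "\<forall>e\<in>M. e \<subseteq> V \<and> card e = 2"
  shows "card {(u, v). u \<in> V \<and> v \<in> V \<and> u \<noteq> v \<and> {u, v} \<notin> M} + 2 * card M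
    = card V * card V - card V"
proof -
  let ?D = "{(u, v). u \<in> V \<and> v \<in> V \<and> u \<noteq> v \<and> {u, v} \<notin> M}" and ?P = "{(u, v). {u, v} \<in> M}"
  have P: "finite ?P" "card ?P = 2 * card M"
    using card_pairs_of_doubletons[OF assms(2)] assms(3) by auto
  have "?D \<union> ?P = V \<times> V - (\<lambda>x. (x, x)) ` V"
    using assms(3) by fastforce
  moreover have "card (V \<times> V - (\<lambda>x. (x, x)) ` V) = card V * card V - card V"
    using assms(1)
    by (subst card_Diff_subset) (auto simp: card_cartesian_product card_image inj_on_def)
  moreover have "finite ?D" by (rule finite_subset[of _ "V \<times> V"]) (use assms(1) in auto)
  then have "card (?D \<union> ?P) = card ?D + card ?P" using P by (intro card_Un_disjoint) auto
  ultimately show ?thesis using P(2) by simp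
qed

section \<open>Lower and upper bounds on the number of colours\<close>

text \<open>Pigeonhole: some class meets \<open>S\<close> in at least \<open>m\<close> vertices and
  so contains a copy. Allowing \<open>S\<close> to be smaller than the vertex set makes it possible
  to leave out an end of a deleted edge.\<close>

lemma not_free_colouring_if_almost_complete:
  assumes G: "complete_minus_matching m t G" and "finite S" and "S \<subseteq> pverts H"
    and card: "j * (m - 1) < card S"
    and M: "finite M" "\<forall>e\<in>M. card e = 2" "disjoint M" "card M \<le> t"
    and adj: "\<And>u v. \<lbrakk>u \<in> S; v \<in> S; u \<noteq> v; {u, v} \<notin> M\<rbrakk> \<Longrightarrow> (u, v) \<in> parcs H"
  shows "\<not> free_colouring G j H \<pi>"
proof
  assume col: "free_colouring G j H \<pi>"
  let ?S = "\<lambda>i. {v \<in> S. \<pi> v = i}"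
  have "card (?S i) \<le> m - 1" if "i \<in> {1..j}" for i
  proof (rule ccontr)
    assume "\<not> card (?S i) \<le> m - 1"
    then have "contains_copy (with_proj H \<restriction> {v \<in> pverts H. \<pi> v = i}) G"
      using assms by (intro contains_copy_complete_minus_matching[OF G, of "?S i" _ M]) auto
    then show False using col that unfolding free_colouring_def by blast
  qed
  then have "(\<Sum>i\<in>{1..j}. card (?S i)) \<le> j * (m - 1)"
    using sum_bounded_above[of "{1..j}" "\<lambda>i. card (?S i)" "m - 1"] by simp
  moreover have "S = (\<Union>i\<in>{1..j}. ?S i)"
    using col assms(3) unfolding free_colouring_def by auto
  then have "card S \<le> (\<Sum>i\<in>{1..j}. card (?S i))"
    using card_UN_le[of "{1..j}" ?S] by simp
  ultimately show False using card by simp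
qed

text \<open>Number the vertices from 0 and cut the numbering into blocks of length
  \<open>s\<close>.\<close>

lemma colouring_with_small_classes:
  assumes "finite V" and "card V \<le> q * s"
  shows "\<exists>\<pi>. \<pi> \<in> V \<rightarrow> {..<q} \<and> (\<forall>i. card {v \<in> V. \<pi> v = i} \<le> s)"
proof -
  obtain h where h: "bij_betw h V {0..<card V}"
    using ex_bij_betw_finite_nat[OF assms(1)] by blast
  have "h v div s < q" if "v \<in> V" for v
  proof -
    have "h v < q * s" using bij_betwE[OF h] that assms(2) by fastforce
    then show ?thesis by (simp add: less_mult_imp_div_less)
  qed
  moreover have "card {v \<in> V. h v div s = i} \<le> s" for i
  proof (cases "s = 0")
    \<comment> \<open>The bound on \<open>card V\<close> makes \<open>V\<close> empty here.\<close>
    case True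
    then show ?thesis using assms by simp
  next
    case False
    have "inj_on h {v \<in> V. h v div s = i}"
      using h by (auto simp: bij_betw_def inj_on_def)
    moreover have "h ` {v \<in> V. h v div s = i} \<subseteq> {i * s..<i * s + s}"
      using False dividend_less_div_times[of s] by (auto simp: add.commute)
    ultimately show ?thesis
      using card_inj_on_le[of h _ "{i * s..<i * s + s}"] by simp
  qed
  ultimately show ?thesis by (intro exI[of _ "\<lambda>v. h v div s"]) auto
qed

section \<open>The chromatic number of \<open>R\<close> and of \<open>R\<close> with one edge
  deleted\<close>

theorem theorem15:
  fixes k m t :: nat
    and R :: "'a pair_pre_digraph"
    and G :: "'b pair_pre_digraph"
  assumes "k \<ge> 1"
    and "real t \<le> real m / 2 - 1"
    and "complete_minus_matching ((k - 1) * (m - 1) + 1) t R"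
    and "complete_minus_matching m t G"
  shows "k_free_minimal k G R"
proof -
  note G = assms(4)
  note wfG = complete_minus_matching_wf[OF G]
  \<comment> \<open>This says that \<open>t + 1\<close> edges cover at most \<open>m\<close>
    vertices; it also gives \<open>m \<ge> 2\<close>, so \<open>m - 1\<close> is positive.\<close>
  have mt: "2 * t + 2 \<le> m" using assms(2) by linarith
  let ?V = "pverts R" and ?n = "(k - 1) * (m - 1) + 1"
  obtain M where R: "finite ?V" "card ?V = ?n"
    "parcs R = {(u, v). u \<in> ?V \<and> v \<in> ?V \<and> u \<noteq> v \<and> {u, v} \<notin> M}"
    and M: "finite M" "\<forall>e\<in>M. e \<subseteq> ?V \<and> card e = 2" "disjoint M" "card M = t"
    using assms(3) by (rule complete_minus_matchingE)
  obtain N where N: "finite (pverts G)" "card (pverts G) = m"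
    "parcs G = {(u, v). u \<in> pverts G \<and> v \<in> pverts G \<and> u \<noteq> v \<and> {u, v} \<notin> N}"
    "finite N" "\<forall>e\<in>N. e \<subseteq> pverts G \<and> card e = 2" "card N = t"
    using G by (rule complete_minus_matchingE)
  have small: "\<not> contains_copy (with_proj H \<restriction> W) G"
    if "finite W" "card W \<le> m - 1" for H :: "'a pair_pre_digraph" and W
    using contains_copy_card_le(1)[OF wfG, of H W] that N(2) mt by auto

  have chi: "free_chromatic_number G R = k"
    unfolding free_chromatic_number_def
  proof (rule Least_equality)
    have "k * (m - 1) = (k - 1) * (m - 1) + (m - 1)"
      using assms(1) by (cases k) auto
    then have "card ?V \<le> k * (m - 1)" using R(2) mt by linarith
    from colouring_with_small_classes[OF R(1) this]
    obtain \<pi> where \<pi>: "\<pi> \<in> ?V \<rightarrow> {..<k}" "\<And>i. card {v \<in> ?V. \<pi> v = i} \<le> m - 1" by blast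
    \<comment> \<open>Blocks are numbered from 0 but colours from 1; after the shift class 0 is
      empty.\<close>
    have "card {v \<in> ?V. Suc (\<pi> v) = i} \<le> m - 1" for i
      using \<pi>(2)[of "i - 1"] R(1) by (cases i) auto
    moreover have "Suc (\<pi> v) \<in> {1..k}" if "v \<in> ?V" for v
      using \<pi>(1) that by (auto simp: Suc_le_eq)
    ultimately have "free_colouring G k R (\<lambda>v. Suc (\<pi> v))"
      unfolding free_colouring_def using R(1) small by simp
    then show "\<exists>\<pi>. free_colouring G k R \<pi>" by blast
  next
    fix j assume "\<exists>\<pi>. free_colouring G j R \<pi>"
    then obtain \<pi> where \<pi>: "free_colouring G j R \<pi>" by blast
    show "k \<le> j"
    proof (rule ccontr)
      assume "\<not> k \<le> j"
      then have "j * (m - 1) \<le> (k - 1) * (m - 1)" by (intro mult_le_mono1) simp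
      then have "j * (m - 1) < card ?V" using R(2) by linarith
      then have "\<not> free_colouring G j R \<pi>"
        using R M
        by (intro not_free_colouring_if_almost_complete[OF G, where S = ?V and M = M]) auto
      then show False using \<pi> by blast
    qed
  qed

  have "free_chromatic_number G (delete_edges R {e}) = k - 1" if e: "e \<in> edges R" for e
    unfolding free_chromatic_number_def
  proof (rule Least_equality)
    let ?H = "delete_edges R {e}"
    obtain x y where xy: "e = {x, y}" "x \<in> ?V" "y \<in> ?V" "x \<noteq> y" "e \<notin> M"
      using e R(3) unfolding edges_def by auto
    have V: "pverts ?H = ?V" by (simp add: delete_edges_def)
    have arcsH: "parcs ?H = {(u, v). u \<in> ?V \<and> v \<in> ?V \<and> u \<noteq> v \<and> {u, v} \<notin> insert e M}"
      using R(3) by (auto simp: delete_edges_def)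
    \<comment> \<open>An edge needs two vertices, which rules out \<open>k = 1\<close> and makes
      \<open>k - 2\<close> a genuine difference.\<close>
    have "card {x, y} \<le> card ?V" using xy R(1) by (intro card_mono) auto
    then have "(k - 1) * (m - 1) \<noteq> 0" using xy(4) R(2) by auto
    then have k2: "k \<ge> 2" by (cases "k \<ge> 2") auto
    then have k_eq: "(k - 1) * (m - 1) = (k - 2) * (m - 1) + (m - 1)"
      by (metis Suc_1 Suc_diff_le add.commute diff_Suc_Suc mult_Suc)
    have mV: "m \<le> card ?V" using R(2) k_eq mt by linarith
    show "\<exists>\<pi>. free_colouring G (k - 1) ?H \<pi>"
    proof -
      \<comment> \<open>\<open>?U\<close> consists of all ends of the \<open>t + 1\<close> missing
        pairs. Any \<open>m\<close>-set \<open>W\<close> around it misses one edge more than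
        \<open>G\<close> does.\<close>
      let ?U = "\<Union>(insert e M)"
      have "card ?U \<le> (\<Sum>a\<in>insert e M. card a)"
        using M(1) card_Union_le_sum_card by blast
      also have "\<dots> = 2 * (t + 1)" using M xy by simp
      finally have "card ?U \<le> m" using mt by simp
      moreover have UV: "?U \<subseteq> ?V" using M(2) xy by auto
      ultimately obtain W where W: "?U \<subseteq> W" "W \<subseteq> ?V" "card W = m"
        using exists_subset_between[OF _ mV _ R(1)] by metis
      have finW: "finite W" using W(2) R(1) finite_subset by blast
      have noW: "\<not> contains_copy (with_proj ?H \<restriction> W) G"
      proof
        assume "contains_copy (with_proj ?H \<restriction> W) G"
        then have "card (parcs G) \<le> card (parcs ?H \<inter> W \<times> W)"
          by (rule contains_copy_card_le(2)[OF wfG _ finW])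
        also have "parcs ?H \<inter> W \<times> W
          = {(u, v). u \<in> W \<and> v \<in> W \<and> u \<noteq> v \<and> {u, v} \<notin> insert e M}"
          unfolding arcsH using W(2) by auto
        finally have "card (parcs G) \<le> card \<dots>" .
        moreover have "card {(u, v). u \<in> W \<and> v \<in> W \<and> u \<noteq> v \<and> {u, v} \<notin> insert e M}
            + 2 * card (insert e M) = card W * card W - card W"
        proof (rule card_ordered_pairs_minus)
          show "\<forall>a\<in>insert e M. a \<subseteq> W \<and> card a = 2" using W(1) M(2) xy by auto
        qed (use finW M(1) in auto)
        moreover have "card (parcs G) + 2 * card N
            = card (pverts G) * card (pverts G) - card (pverts G)"
          unfolding N(3) using N by (intro card_ordered_pairs_minus) auto
        ultimately show False using N M xy W(3) by simp
      qed
      \<comment> \<open>Since \<open>W\<close> has \<open>m\<close> rather than \<open>m - 1\<close>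
        vertices, it absorbs the extra vertex of \<open>R\<close>, leaving exactly
        \<open>(k - 2) * (m - 1)\<close>.\<close>
      have "card (?V - W) = card ?V - m"
        using W finW by (simp add: card_Diff_subset)
      then have "card (?V - W) \<le> (k - 2) * (m - 1)" using R(2) k_eq mt by linarith
      from colouring_with_small_classes[OF _ this] R(1)
      obtain \<pi> where \<pi>: "\<pi> \<in> ?V - W \<rightarrow> {..<k - 2}"
        "\<And>i. card {v \<in> ?V - W. \<pi> v = i} \<le> m - 1" by auto
      \<comment> \<open>Colour 1 is reserved for \<open>W\<close>; the values of
        \<open>\<pi>\<close> start at 0 and are moved to \<open>2, ..., k - 1\<close>.\<close>
      define \<rho> where "\<rho> = (\<lambda>v. if v \<in> W then 1 else \<pi> v + 2)"
      have "free_colouring G (k - 1) ?H \<rho>"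
        unfolding free_colouring_def V
      proof (intro conjI ballI)
        show "\<rho> \<in> ?V \<rightarrow> {1..k - 1}"
          using \<pi>(1) k2 by (fastforce simp: \<rho>_def Pi_def)
        fix i assume "i \<in> {1..k - 1}"
        show "\<not> contains_copy (with_proj ?H \<restriction> {v \<in> ?V. \<rho> v = i}) G"
        proof (cases "i = 1")
          case True
          then have "{v \<in> ?V. \<rho> v = i} = W" using W(2) by (auto simp: \<rho>_def)
          then show ?thesis using noW by simp
        next
          case False
          then have "{v \<in> ?V. \<rho> v = i} \<subseteq> {v \<in> ?V - W. \<pi> v = i - 2}"
            by (auto simp: \<rho>_def)
          then have "card {v \<in> ?V. \<rho> v = i} \<le> card {v \<in> ?V - W. \<pi> v = i - 2}"
            using R(1) by (intro card_mono) auto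
          then show ?thesis using \<pi>(2)[of "i - 2"] R(1) by (intro small) auto
        qed
      qed
      then show ?thesis by blast
    qed
    fix j assume "\<exists>\<pi>. free_colouring G j ?H \<pi>"
    then obtain \<pi> where \<pi>: "free_colouring G j ?H \<pi>" by blast
    show "k - 1 \<le> j"
    proof (rule ccontr)
      assume "\<not> k - 1 \<le> j"
      then have "j * (m - 1) < (k - 1) * (m - 1)" using mt by simp
      \<comment> \<open>Without \<open>x\<close> the pair \<open>e\<close> disappears, so only the
        \<open>t\<close> edges of \<open>M\<close> can be missing, and
        \<open>(k - 1) * (m - 1)\<close> vertices remain.\<close>
      then have "j * (m - 1) < card (?V - {x})" using R xy by simp
      then have "\<not> free_colouring G j ?H \<pi>"
        using R(1) M arcsH xy(1) V
        by (intro not_free_colouring_if_almost_complete[OF G, where S = "?V - {x}" and M = M])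
          (auto simp: doubleton_eq_iff)
      then show False using \<pi> by blast
    qed
  qed
  \<comment> \<open>By \<open>k \<ge> 1\<close> the natural number \<open>k - 1\<close> agrees with
    the integer difference in \<open>free_minimal\<close>.\<close>
  then show ?thesis
    unfolding k_free_minimal_def free_minimal_def using chi assms(1) by auto
qed

end
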